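(* Suppose that $\phi_2(\theta,t)$, $\psi_1(\theta,t)$ are smooth solutions (for $\theta\in\mathbb{R}$ and $t$ in a time interval) of the system $$\left[\psi_{1t} + b_R^\prime\, \phi_2\, \psi_{1\theta} + \left(\frac{b_{Rt}}{2b_R} + \frac{q_{Rt}}{q_R}\right)\psi_1\right]_\theta = 0,\qquad \phi_{2\theta\theta} = \left(\frac{q_R^2\, b_R\, b_R^\prime}{a_R^2 - b_R^2}\right) \psi_{1\theta}^2,$$ such that $\psi_{1\theta}(\cdot,t)$ has compact support for each $t$. Then $$\frac{d}{dt}\left\{ \left(\frac{a_R^2 - b_R^2}{b_R^\prime}\right) \left[\phi_{2\theta}\right]\right\} + \left(\frac{a_R^2 - b_R^2}{2}\right) \left[\phi_{2\theta}^2\right] = 0,$$ where $[f](t) = \lim_{\theta\to+\infty} f(\theta,t) - \lim_{\theta\to-\infty} f(\theta,t)$ denotes the jump from $\theta=-\infty$ to $\theta=\infty$.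
   Context: Here $a(\phi)>0$, $b(\phi)>0$, $q(\phi)$ are given smooth real functions of a real variable $\phi$ (in the director-field application, $a^2 = \alpha\sin^2\phi+\gamma\cos^2\phi$, $b^2=\beta\sin^2\phi+\gamma\cos^2\phi$, $q^2=\sin^2\phi$ with positive constants $\alpha,\beta,\gamma$), and a prime denotes the derivative with respect to $\phi$. A smooth real function $\phi_R(t)$ of time is given, and a subscript $R$ on a function of $\phi$ denotes evaluation at $\phi=\phi_R(t)$, so $a_R(t)=a(\phi_R(t))$, $b_R(t)=b(\phi_R(t))$, $q_R(t)=q(\phi_R(t))$, $b_R^\prime(t)=b^\prime(\phi_R(t))$; also $b_{Rt}=\frac{d}{dt}b_R(t)$ and $q_{Rt}=\frac{d}{dt}q_R(t)$. It is assumed that $a_R\neq b_R$, $b_R^\prime\neq 0$ and $q_R\neq0$ throughout the time interval. Subscripts $\theta$, $t$ on $\phi_2,\psi_1$ denote partial derivatives. *)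

theory Defs
  imports "HOL-Analysis.Analysis"
begin

(* For open S in a finite-dimensional space this is the usual C^k: "frechet_derivative f (at x) v" is the directional
   derivative of f at x in the direction v. *)
primrec Ck_on :: "nat \<Rightarrow> ('a::real_normed_vector \<Rightarrow> 'b::real_normed_vector) \<Rightarrow> 'a set \<Rightarrow> bool" where
  "Ck_on 0 f S \<longleftrightarrow> continuous_on S f"
| "Ck_on (Suc k) f S \<longleftrightarrow>
     (\<forall>x\<in>S. f differentiable (at x)) \<and> (\<forall>v. Ck_on k (\<lambda>x. frechet_derivative f (at x) v) S)"

definition smooth_on :: "('a::real_normed_vector \<Rightarrow> 'b::real_normed_vector) \<Rightarrow> 'a set \<Rightarrow> bool" where
  "smooth_on f S \<longleftrightarrow> (\<forall>k. Ck_on k f S)"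

(* Partial derivatives of a function of (\<theta>, t), in that argument order. *)
definition D\<theta> :: "(real \<Rightarrow> real \<Rightarrow> real) \<Rightarrow> real \<Rightarrow> real \<Rightarrow> real" where
  "D\<theta> f \<theta> t = deriv (\<lambda>x. f x t) \<theta>"

definition Dt :: "(real \<Rightarrow> real \<Rightarrow> real) \<Rightarrow> real \<Rightarrow> real \<Rightarrow> real" where
  "Dt f \<theta> t = deriv (\<lambda>s. f \<theta> s) t"

definition jump :: "(real \<Rightarrow> real) \<Rightarrow> real" where
  "jump f = Lim at_top f - Lim at_bot f"

(* "Lim" is an arbitrary value when the limit does not exist; this predicate says that
   both limits in "jump f" exist. *)
definition has_jump :: "(real \<Rightarrow> real) \<Rightarrow> bool" where
  "has_jump f \<longleftrightarrow> (\<exists>l. (f \<longlongrightarrow> l) at_top) \<and> (\<exists>l. (f \<longlongrightarrow> l) at_bot)"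

end

theory Submission
  imports Defs
begin

text \<open>
  Write $w = \psi_{1\theta}$, $n = (a_R^2 - b_R^2)/b_R'$ and $A = b_R'$. Combining the
  $\theta$-derivative of the first equation with the $t$- and $\theta$-derivatives of
  $n \phi_{2\theta\theta} = q_R^2 b_R w^2$ shows that
  $n_t \phi_{2\theta} + n \phi_{2\theta t} + n A (\phi_2 \phi_{2\theta\theta} + \phi_{2\theta}^2/2)$
  does not depend on $\theta$. Comparing its values to the right and to the left of the support
  of $w$, where $\phi_{2\theta\theta} = 0$, gives the jump law.

  To differentiate the jump in $t$, the support of $w(\cdot, t)$ must be bounded locally uniformly
  in $t$, although it is only assumed to be compact for each $t$. Now $w$ is transported with
  speed $v = A \phi_2$, and $p = v_\theta$ satisfies a Riccati equation along characteristics,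
  with coefficients depending on $t$ only. Followed backwards in time, such a solution is bounded
  below; as $p$ is monotone in $\theta$, this bounds $v$ from below by a linear function,
  so nothing can enter from infinity in finite time.
\<close>

subsection \<open>Smooth functions and mixed partial derivatives\<close>

text \<open>Derivatives are local, and openness of \<open>S\<close> turns agreement on
  \<open>S\<close> into agreement near each point. This lets \<open>deriv\<close>,
  \<open>D\<theta>\<close> and \<open>Dt\<close> replace \<open>frechet_derivative\<close>.\<close>

lemma Ck_on_cong:
  assumes "open S" "\<And>x. x \<in> S \<Longrightarrow> f x = g x" "Ck_on k f S"
  shows "Ck_on k g S"
  using assms(2,3)
proof (induction k arbitrary: f g)
  case 0
  then show ?case by (metis Ck_on.simps(1) continuous_on_cong)
next
  case (Suc k)
  have diff: "g differentiable at x" if "x \<in> S" for x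
    using Suc.prems that \<open>open S\<close> unfolding Ck_on.simps differentiable_def
    by (meson has_derivative_transform_within_open)
  have "Ck_on k (\<lambda>x. frechet_derivative g (at x) v) S" for v
  proof (rule Suc.IH)
    show "Ck_on k (\<lambda>x. frechet_derivative f (at x) v) S" using Suc.prems by simp
    show "frechet_derivative f (at x) v = frechet_derivative g (at x) v" if "x \<in> S" for x
      using frechet_derivative_transform_within_open[of f x S g] Suc.prems that \<open>open S\<close> by simp
  qed
  then show ?case using diff by simp
qed

lemma smooth_on_cong:
  assumes "open S" "\<And>x. x \<in> S \<Longrightarrow> f x = g x" "smooth_on f S"
  shows "smooth_on g S"
  using assms Ck_on_cong unfolding smooth_on_def by blast

lemma smooth_on_continuous: "smooth_on f S \<Longrightarrow> continuous_on S f"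
  unfolding smooth_on_def by (metis Ck_on.simps(1))

lemma smooth_on_differentiable: "smooth_on f S \<Longrightarrow> x \<in> S \<Longrightarrow> f differentiable at x"
  unfolding smooth_on_def by (metis Ck_on.simps(2))

lemma smooth_on_frechet_derivative:
  "smooth_on f S \<Longrightarrow> smooth_on (\<lambda>x. frechet_derivative f (at x) v) S"
  unfolding smooth_on_def by (metis Ck_on.simps(2))

lemma smooth_on_DERIV:
  fixes f :: "real \<Rightarrow> real"
  assumes "smooth_on f S" "x \<in> S"
  shows "(f has_real_derivative deriv f x) (at x)"
  using smooth_on_differentiable[OF assms] DERIV_deriv_iff_real_differentiable by blast

lemma smooth_on_deriv:
  fixes f :: "real \<Rightarrow> real"
  assumes "open S" "smooth_on f S"
  shows "smooth_on (deriv f) S"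
proof (rule smooth_on_cong[OF \<open>open S\<close>])
  show "smooth_on (\<lambda>x. frechet_derivative f (at x) 1) S"
    by (rule smooth_on_frechet_derivative[OF assms(2)])
  show "frechet_derivative f (at x) 1 = deriv f x" if "x \<in> S" for x
    using fun_cong[OF frechet_derivative_at[OF smooth_on_DERIV[OF assms(2) that, unfolded has_field_derivative_def]], of 1]
    by simp
qed

text \<open>Compose the total derivative with the embeddings of the two coordinate lines through
  \<open>(x, t)\<close>; a linear map on the reals is multiplication by its value at 1.\<close>

lemma
  fixes f :: "real \<Rightarrow> real \<Rightarrow> real"
  assumes f: "smooth_on (\<lambda>(x, t). f x t) (UNIV \<times> I)" and "t \<in> I"
  shows has_D\<theta>: "((\<lambda>x. f x t) has_real_derivative D\<theta> f x t) (at x)"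
    and has_Dt: "((\<lambda>s. f x s) has_real_derivative Dt f x t) (at t)"
    and D\<theta>_eq_frechet: "D\<theta> f x t = frechet_derivative (\<lambda>(x, t). f x t) (at (x, t)) (1, 0)"
    and Dt_eq_frechet: "Dt f x t = frechet_derivative (\<lambda>(x, t). f x t) (at (x, t)) (0, 1)"
proof -
  let ?F = "\<lambda>(x, t). f x t"
  let ?F' = "frechet_derivative ?F (at (x, t))"
  have F: "(?F has_derivative ?F') (at (x, t))"
    using smooth_on_differentiable[OF f, of "(x, t)"] \<open>t \<in> I\<close> frechet_derivative_works by auto
  then have lin: "linear ?F'" using has_derivative_linear by blast
  have *: "?F' (h, 0) = ?F' (1, 0) * h" "?F' (0, h) = ?F' (0, 1) * h" for h
    using linear_cmul[OF lin, of h "(1,0)"] linear_cmul[OF lin, of h "(0,1)"] by simp_all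
  then have mult: "(\<lambda>h. ?F' (h, 0)) = (*) (?F' (1, 0))" "(\<lambda>h. ?F' (0, h)) = (*) (?F' (0, 1))"
    by blast+
  have "((\<lambda>x. f x t) has_derivative (\<lambda>h. ?F' (h, 0))) (at x)"
    using has_derivative_compose[of "\<lambda>x. (x, t)" "\<lambda>h. (h, 0)" x UNIV ?F ?F'] F
    by (simp add: has_derivative_Pair)
  then have 1: "((\<lambda>x. f x t) has_real_derivative ?F' (1, 0)) (at x)"
    unfolding has_field_derivative_def mult(1) .
  have "((\<lambda>t. f x t) has_derivative (\<lambda>h. ?F' (0, h))) (at t)"
    using has_derivative_compose[of "\<lambda>t. (x, t)" "\<lambda>h. (0, h)" t UNIV ?F ?F'] F
    by (simp add: has_derivative_Pair)
  then have 2: "((\<lambda>s. f x s) has_real_derivative ?F' (0, 1)) (at t)"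
    unfolding has_field_derivative_def mult(2) .
  show "D\<theta> f x t = ?F' (1, 0)" "Dt f x t = ?F' (0, 1)"
    unfolding D\<theta>_def Dt_def by (rule DERIV_imp_deriv[OF 1] DERIV_imp_deriv[OF 2])+
  then show "((\<lambda>x. f x t) has_real_derivative D\<theta> f x t) (at x)"
    and "((\<lambda>s. f x s) has_real_derivative Dt f x t) (at t)"
    using 1 2 by simp_all
qed

lemma
  fixes f :: "real \<Rightarrow> real \<Rightarrow> real"
  assumes "open I" and f: "smooth_on (\<lambda>(x, t). f x t) (UNIV \<times> I)"
  shows smooth_on_D\<theta>: "smooth_on (\<lambda>(x, t). D\<theta> f x t) (UNIV \<times> I)"
    and smooth_on_Dt: "smooth_on (\<lambda>(x, t). Dt f x t) (UNIV \<times> I)"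
proof -
  have op: "open (UNIV \<times> I)" using \<open>open I\<close> by (simp add: open_Times)
  show "smooth_on (\<lambda>(x, t). D\<theta> f x t) (UNIV \<times> I)"
    by (rule smooth_on_cong[OF op _ smooth_on_frechet_derivative[OF f, of "(1, 0)"]])
       (auto simp: D\<theta>_eq_frechet[OF f])
  show "smooth_on (\<lambda>(x, t). Dt f x t) (UNIV \<times> I)"
    by (rule smooth_on_cong[OF op _ smooth_on_frechet_derivative[OF f, of "(0, 1)"]])
       (auto simp: Dt_eq_frechet[OF f])
qed

text \<open>With \<open>u\<close> equal to the transport speed at \<open>(x, t)\<close> this is the
  derivative along the characteristic, obtained without constructing that curve.\<close>

lemma DERIV_along_line:
  fixes f :: "real \<Rightarrow> real \<Rightarrow> real"
  assumes f: "smooth_on (\<lambda>(x, t). f x t) (UNIV \<times> I)" and "t \<in> I"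
  shows "((\<lambda>s. f (x + s * u) (t + s)) has_real_derivative u * D\<theta> f x t + Dt f x t) (at 0)"
proof -
  let ?F = "\<lambda>(x, t). f x t"
  let ?F' = "frechet_derivative ?F (at (x, t))"
  have F: "(?F has_derivative ?F') (at (x, t))"
    using smooth_on_differentiable[OF f, of "(x, t)"] \<open>t \<in> I\<close> frechet_derivative_works by auto
  then have lin: "linear ?F'" using has_derivative_linear by blast
  have *: "?F' (h * u, h) = (u * D\<theta> f x t + Dt f x t) * h" for h
  proof -
    have "?F' (h * u, h) = ?F' ((h * u) *\<^sub>R (1, 0) + h *\<^sub>R (0, 1))" by simp
    also have "\<dots> = (h * u) *\<^sub>R ?F' (1, 0) + h *\<^sub>R ?F' (0, 1)"
      by (simp only: linear_add[OF lin] linear_cmul[OF lin])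
    also have "\<dots> = (u * D\<theta> f x t + Dt f x t) * h"
      unfolding D\<theta>_eq_frechet[OF assms] Dt_eq_frechet[OF assms] by (simp only: real_scaleR_def) algebra
    finally show ?thesis .
  qed
  have "((\<lambda>s. (x + s * u, t + s)) has_derivative (\<lambda>h. (h * u, h))) (at 0)"
    by (auto intro!: derivative_eq_intros)
  from has_derivative_compose[OF this, of ?F ?F'] F
  have "((\<lambda>s. f (x + s * u) (t + s)) has_derivative (\<lambda>h. ?F' (h * u, h))) (at 0)"
    by simp
  then show ?thesis unfolding has_field_derivative_def * .
qed

section \<open>Symmetry of mixed partial derivatives\<close>

text \<open>Mean value theorem twice: in \<open>y\<close> for the increment over
  \<open>{t..t+h}\<close>, then in \<open>s\<close> for \<open>fx\<close>. The second difference is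
  symmetric in the two variables, so the lemma serves both orders of differentiation.\<close>

lemma second_difference_mean_value:
  fixes f fx fxt :: "real \<Rightarrow> real \<Rightarrow> real"
  assumes "h > 0"
    and fx: "\<And>y s. y \<in> {x..x+h} \<Longrightarrow> s \<in> {t..t+h} \<Longrightarrow> ((\<lambda>y. f y s) has_real_derivative fx y s) (at y)"
    and fxt: "\<And>y s. y \<in> {x..x+h} \<Longrightarrow> s \<in> {t..t+h} \<Longrightarrow> ((\<lambda>s. fx y s) has_real_derivative fxt y s) (at s)"
  obtains y s where "y \<in> {x..x+h}" "s \<in> {t..t+h}"
    "f (x+h) (t+h) - f (x+h) t - f x (t+h) + f x t = h\<^sup>2 * fxt y s"
proof -
  have "\<exists>y>x. y < x + h \<and> (f (x+h) (t+h) - f (x+h) t) - (f x (t+h) - f x t)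
      = (x + h - x) * (fx y (t+h) - fx y t)"
    by (rule MVT2) (use \<open>h > 0\<close> in \<open>auto intro!: derivative_intros fx\<close>)
  then obtain y where "x < y" "y < x + h"
    "(f (x+h) (t+h) - f (x+h) t) - (f x (t+h) - f x t) = (x + h - x) * (fx y (t+h) - fx y t)" by blast
  then have y: "y \<in> {x..x+h}"
    "f (x+h) (t+h) - f (x+h) t - f x (t+h) + f x t = h * (fx y (t+h) - fx y t)" by simp_all
  have "\<exists>s>t. s < t + h \<and> fx y (t+h) - fx y t = (t + h - t) * fxt y s"
    by (rule MVT2) (use \<open>h > 0\<close> y in \<open>auto intro!: fxt\<close>)
  then obtain s where "t < s" "s < t + h" "fx y (t+h) - fx y t = (t + h - t) * fxt y s" by blast
  then have "s \<in> {t..t+h}" "fx y (t+h) - fx y t = h * fxt y s" by simp_all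
  with y show ?thesis by (intro that[of y s]) (auto simp: power2_eq_square)
qed

lemma D\<theta>_Dt_commute:
  fixes f :: "real \<Rightarrow> real \<Rightarrow> real"
  assumes "open I" and f: "smooth_on (\<lambda>(x, t). f x t) (UNIV \<times> I)" and "t \<in> I"
  shows "D\<theta> (Dt f) x t = Dt (D\<theta> f) x t"
proof (rule ccontr)
  let ?A = "Dt (D\<theta> f)" and ?B = "D\<theta> (Dt f)"
  assume "?B x t \<noteq> ?A x t"
  \<comment> \<open>Half the gap: a value within \<open>e\<close> of \<open>?A x t\<close> and one
    within \<open>e\<close> of \<open>?B x t\<close> cannot coincide.\<close>
  define e where "e = \<bar>?B x t - ?A x t\<bar> / 2"
  have "e > 0" using \<open>?B x t \<noteq> ?A x t\<close> by (simp add: e_def)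
  have smooth: "smooth_on (\<lambda>(x, t). ?A x t) (UNIV \<times> I)" "smooth_on (\<lambda>(x, t). ?B x t) (UNIV \<times> I)"
    using f \<open>open I\<close> smooth_on_D\<theta> smooth_on_Dt by blast+
  have op: "open (UNIV \<times> I)" using \<open>open I\<close> by (simp add: open_Times)
  have "isCont (\<lambda>(x, t). ?A x t) (x, t)" "isCont (\<lambda>(x, t). ?B x t) (x, t)"
    using smooth[THEN smooth_on_continuous] \<open>t \<in> I\<close> op continuous_on_eq_continuous_at by fastforce+
  then have "\<exists>d>0. \<forall>z. dist z (x, t) < d \<longrightarrow> dist (case z of (x, t) \<Rightarrow> ?A x t) (?A x t) < e"
    "\<exists>d>0. \<forall>z. dist z (x, t) < d \<longrightarrow> dist (case z of (x, t) \<Rightarrow> ?B x t) (?B x t) < e"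
    using \<open>e > 0\<close> unfolding continuous_at_eps_delta by simp_all
  then obtain d1 d2 where d: "d1 > 0" "d2 > 0"
    "\<And>z. dist z (x, t) < d1 \<Longrightarrow> dist (case z of (x, t) \<Rightarrow> ?A x t) (?A x t) < e"
    "\<And>z. dist z (x, t) < d2 \<Longrightarrow> dist (case z of (x, t) \<Rightarrow> ?B x t) (?B x t) < e"
    by metis
  obtain d3 where d3: "d3 > 0" "ball t d3 \<subseteq> I" using \<open>open I\<close> \<open>t \<in> I\<close> openE by blast
  \<comment> \<open>Points of the square of side \<open>h\<close> are within \<open>2 * h\<close> of
    its corner \<open>(x, t)\<close>; the factor 3 leaves strict room.\<close>
  define h where "h = min (min d1 d2) d3 / 3"
  have h: "h > 0" "3 * h \<le> d1" "3 * h \<le> d2" "3 * h \<le> d3" using d d3 by (auto simp: h_def)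
  have inI: "s \<in> I" if "s \<in> {t..t+h}" for s
    using that h d3 by (auto simp: subset_eq dist_real_def)
  have close: "dist (y, s) (x, t) < d1" "dist (y, s) (x, t) < d2"
    if "y \<in> {x..x+h}" "s \<in> {t..t+h}" for y s
  proof -
    have "dist (y, s) (x, t) \<le> dist y x + dist s t"
      by (metis dist_Pair_Pair sqrt_sum_squares_le_sum zero_le_dist)
    also have "\<dots> < 3 * h" using that h(1) by (auto simp: dist_real_def)
    finally show "dist (y, s) (x, t) < d1" "dist (y, s) (x, t) < d2" using h by auto
  qed
  note sm = f smooth_on_D\<theta>[OF \<open>open I\<close> f] smooth_on_Dt[OF \<open>open I\<close> f]
  obtain y s where 1: "y \<in> {x..x+h}" "s \<in> {t..t+h}"
    "f (x+h) (t+h) - f (x+h) t - f x (t+h) + f x t = h\<^sup>2 * ?A y s"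
    by (rule second_difference_mean_value[of h x t f "D\<theta> f" ?A])
       (use h inI sm in \<open>auto intro: has_D\<theta> has_Dt\<close>)
  \<comment> \<open>The same square with the variables swapped expresses the same second difference
    through \<open>?B\<close>.\<close>
  obtain s' y' where 2: "s' \<in> {t..t+h}" "y' \<in> {x..x+h}"
    "f (x+h) (t+h) - f x (t+h) - f (x+h) t + f x t = h\<^sup>2 * ?B y' s'"
    by (rule second_difference_mean_value[of h t x "\<lambda>t x. f x t" "\<lambda>t x. Dt f x t" "\<lambda>t x. ?B x t"])
       (use h inI sm in \<open>auto intro: has_D\<theta> has_Dt\<close>)
  have "h\<^sup>2 * ?A y s = h\<^sup>2 * ?B y' s'" using 1(3) 2(3) by linarith
  then have "?A y s = ?B y' s'" using h(1) by simp
  moreover have "dist (?A y s) (?A x t) < e" using d(3)[OF close(1)[OF 1(1,2)]] by simp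
  moreover have "dist (?B y' s') (?B x t) < e" using d(4)[OF close(2)[OF 2(2,1)]] by simp
  moreover have "\<bar>?B x t - ?A x t\<bar> = 2 * e" by (simp add: e_def)
  ultimately show False unfolding dist_real_def by linarith
qed

subsection \<open>Finite speed of propagation\<close>

text \<open>Keeps a backward characteristic inside a region: each constraint reads
  \<open>f \<ge> 0\<close>, and a sign of the derivative is required only where the constraint is
  active.\<close>

lemma DERIV_eventually_nonneg:
  fixes f :: "real \<Rightarrow> real"
  assumes "(f has_real_derivative D) (at 0)" "f 0 \<ge> 0" "f 0 = 0 \<Longrightarrow> D > 0"
  shows "\<forall>\<^sub>F s in at_right 0. f s \<ge> 0"
proof (cases "f 0 = 0")
  case True
  obtain d where "d > 0" "\<forall>h>0. h < d \<longrightarrow> f 0 < f (0 + h)"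
    using DERIV_pos_inc_right assms True by blast
  then show ?thesis unfolding eventually_at_right_field using True by (intro exI[of _ d]) (auto intro: less_imp_le)
next
  case False
  have "(f \<longlongrightarrow> f 0) (at_right 0)"
    using DERIV_isCont[OF assms(1)] by (simp add: isCont_def filterlim_at_split)
  then have "\<forall>\<^sub>F s in at_right 0. f s > 0" using False assms(2) order_tendstoD(1)[of f "f 0"] by simp
  then show ?thesis by (rule eventually_mono) simp
qed

text \<open>
  The assumptions on $w$ and $p$ say $w_t + v w_x = -(p + c) w$ and $p_t + v p_x = -p^2/2 - d p + g$;
  they are stated as directional derivatives to avoid naming partial derivatives.
  The system is invariant under reflection of space and of time.
\<close>

locale transport =
  fixes I :: "real set" and v p w :: "real \<Rightarrow> real \<Rightarrow> real" and c d g :: "real \<Rightarrow> real"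
  assumes open_I: "open I"
    and cont_v: "continuous_on (UNIV \<times> I) (\<lambda>(x, t). v x t)"
    and cont_p: "continuous_on (UNIV \<times> I) (\<lambda>(x, t). p x t)"
    and cont_w: "continuous_on (UNIV \<times> I) (\<lambda>(x, t). w x t)"
    and cont_c: "continuous_on I c" and cont_d: "continuous_on I d" and cont_g: "continuous_on I g"
    and v_deriv: "\<And>x t. t \<in> I \<Longrightarrow> ((\<lambda>x. v x t) has_real_derivative p x t) (at x)"
    and p_mono: "\<And>t. t \<in> I \<Longrightarrow> mono (\<lambda>x. p x t) \<or> antimono (\<lambda>x. p x t)"
    and p_char: "\<And>x t. t \<in> I \<Longrightarrow> ((\<lambda>s. p (x + s * v x t) (t + s)) has_real_derivative
      - (p x t)\<^sup>2 / 2 - d t * p x t + g t) (at 0)"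
    and w_char: "\<And>x t. t \<in> I \<Longrightarrow> ((\<lambda>s. w (x + s * v x t) (t + s)) has_real_derivative
      - (p x t + c t) * w x t) (at 0)"
begin

text \<open>By the mean value theorem the slope is a value of \<open>p\<close> in between, and
  monotonicity in either direction bounds it below by the smaller end value.\<close>

lemma v_lower_bound:
  assumes "t \<in> I" "M \<le> x"
  shows "v x t \<ge> v M t + min (p M t) (p x t) * (x - M)"
proof (cases "M = x")
  case False
  then have "\<exists>z>M. z < x \<and> v x t - v M t = (x - M) * p z t"
    using assms by (intro MVT2 v_deriv) auto
  then obtain z where z: "M < z" "z < x" "v x t - v M t = (x - M) * p z t" by blast
  have "p z t \<ge> min (p M t) (p x t)"
    using p_mono[OF \<open>t \<in> I\<close>] z(1,2) by (auto dest: monoD[of _ M z] antimonoD[of _ z x])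
  then have "(x - M) * min (p M t) (p x t) \<le> (x - M) * p z t"
    using assms by (intro mult_left_mono) auto
  then show ?thesis using z(3) by (simp add: mult.commute)
qed auto

text \<open>
  Instead of solving for characteristics, maximise $w^2 e^{-\Lambda t}$ over a compact set $S$ that no
  backward characteristic leaves: if the maximum were positive, a small step backwards along
  the characteristic direction would increase it.
\<close>

lemma vanishes_right_forward:
  assumes "t0 \<in> I" and w0: "\<And>x. x \<ge> M \<Longrightarrow> w x t0 = 0"
  shows "\<exists>\<delta>>0. \<forall>t\<in>{t0..t0+\<delta>}. \<forall>x\<ge>M+1. w x t = 0"
proof -
  obtain \<delta>0 where \<delta>0: "\<delta>0 > 0" "cball t0 \<delta>0 \<subseteq> I" using open_I \<open>t0 \<in> I\<close> open_contains_cball by blast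
  let ?J = "{t0..t0+\<delta>0}"
  have J: "?J \<subseteq> I" using \<delta>0 by (auto simp: subset_eq dist_real_def)
  have cpt: "compact ({M..M+1} \<times> ?J)" by (simp add: compact_Times)
  have "bounded ((\<lambda>(x, t). v x t) ` ({M..M+1} \<times> ?J))" "bounded ((\<lambda>(x, t). p x t) ` ({M..M+1} \<times> ?J))"
    "bounded (d ` ?J)" "bounded (g ` ?J)"
    by (intro compact_imp_bounded compact_continuous_image cpt compact_Icc
        continuous_on_subset[OF cont_v] continuous_on_subset[OF cont_p]
        continuous_on_subset[OF cont_d] continuous_on_subset[OF cont_g]; use J in auto)+
  then obtain C1 C2 D1 D2 where
    "\<forall>z\<in>{M..M+1} \<times> ?J. \<bar>case z of (x, t) \<Rightarrow> v x t\<bar> \<le> C1"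
    "\<forall>z\<in>{M..M+1} \<times> ?J. \<bar>case z of (x, t) \<Rightarrow> p x t\<bar> \<le> C2"
    "\<forall>t\<in>?J. \<bar>d t\<bar> \<le> D1" "\<forall>t\<in>?J. \<bar>g t\<bar> \<le> D2"
    unfolding bounded_iff ball_simps(9) real_norm_def by blast
  then have
    C1: "\<And>x t. x \<in> {M..M+1} \<Longrightarrow> t \<in> ?J \<Longrightarrow> \<bar>v x t\<bar> \<le> C1" and
    C2: "\<And>x t. x \<in> {M..M+1} \<Longrightarrow> t \<in> ?J \<Longrightarrow> \<bar>p x t\<bar> \<le> C2" and
    D1: "\<And>t. t \<in> ?J \<Longrightarrow> \<bar>d t\<bar> \<le> D1" and
    D2: "\<And>t. t \<in> ?J \<Longrightarrow> \<bar>g t\<bar> \<le> D2"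
    by auto
  \<comment> \<open>\<open>C\<close> controls the unit strip next to \<open>M\<close>,
    \<open>D\<close> the coefficients of the Riccati equation.\<close>
  define C where "C = max 1 (max C1 C2)"
  define D where "D = max 0 (max D1 D2)"
  have C: "C \<ge> 1" "\<And>x t. x \<in> {M..M+1} \<Longrightarrow> t \<in> ?J \<Longrightarrow> \<bar>v x t\<bar> \<le> C \<and> \<bar>p x t\<bar> \<le> C"
    using C1 C2 unfolding C_def by (auto simp: le_max_iff_disj)
  have D: "D \<ge> 0" "\<And>t. t \<in> ?J \<Longrightarrow> \<bar>d t\<bar> \<le> D \<and> \<bar>g t\<bar> \<le> D"
    using D1 D2 unfolding D_def by (auto simp: le_max_iff_disj)
  \<comment> \<open>A left edge starting at \<open>M\<close> with speed \<open>C + 1\<close> stays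
    at most \<open>M + 1\<close> for this long. The choice precedes \<open>x1\<close> and
    \<open>t1\<close>, so it is uniform over the half-line.\<close>
  define \<delta> where "\<delta> = min \<delta>0 (1 / (C + 1))"
  have \<delta>: "\<delta> > 0" "\<delta> \<le> \<delta>0" "(C + 1) * \<delta> \<le> 1"
    using \<delta>0 C(1) by (auto simp: \<delta>_def min_def field_simps)
  have "w x1 t1 = 0" if t1: "t1 \<in> {t0..t0+\<delta>}" and x1: "x1 \<ge> M + 1" for x1 t1
  proof (rule ccontr)
    assume "w x1 t1 \<noteq> 0"
    \<comment> \<open>\<open>- L\<close> is to be a lower barrier for \<open>p\<close>: the term
      \<open>\<bar>p x1 t1\<bar>\<close> secures it at the starting point, \<open>C\<close> at
      \<open>x = M\<close>, and \<open>2 * D + 2\<close> makes the quadratic term dominate on the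
      barrier.\<close>
    define L where "L = C + \<bar>p x1 t1\<bar> + 2 * D + 2"
    have L: "L \<ge> C" "L \<ge> 2 * D + 2" "p x1 t1 \<ge> - L" using C D by (auto simp: L_def)
    \<comment> \<open>The left edge \<open>l\<close> moves faster than \<open>v \<le> C\<close> in
      the strip, so backwards in time it recedes ahead of every characteristic.\<close>
    define l where "l t = M + (C + 1) * (t - t0)" for t
    \<comment> \<open>\<open>M + r\<close> is the right edge. As
      \<open>v \<ge> - C - L * (x - M)\<close>, a backward characteristic on it moves right at rate
      at most \<open>C + L * r\<close>, less than the rate \<open>(L + C) * r\<close> of the edge
      because \<open>r > 1\<close>. The exponential in \<open>A\<close> keeps \<open>r\<close> above
      \<open>x1 - M + 2\<close> until \<open>t1\<close>.\<close>
    define A where "A = (x1 - M + 2) * exp ((L + C) * \<delta>)"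
    define r where "r t = A * exp (- ((L + C) * (t - t0)))" for t
    have LC: "L + C > 0" using C L by simp
    have r_ge: "r t \<ge> x1 - M + 2" if "t \<in> {t0..t1}" for t
    proof -
      have "(L + C) * (t - t0) \<le> (L + C) * \<delta>" using that t1 LC by (intro mult_left_mono) auto
      then have "1 \<le> exp ((L + C) * \<delta> - (L + C) * (t - t0))" by simp
      then have "(x1 - M + 2) * 1 \<le> (x1 - M + 2) * exp ((L + C) * \<delta> - (L + C) * (t - t0))"
        using x1 by (intro mult_left_mono) auto
      also have "\<dots> = r t" unfolding r_def A_def mult.assoc mult_exp_exp by (simp add: algebra_simps)
      finally show ?thesis by simp
    qed
    have "A \<ge> 0" using x1 by (simp add: A_def)
    have r_le: "r t \<le> A" if "t \<ge> t0" for t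
    proof -
      have "0 \<le> (L + C) * (t - t0)" using that LC by simp
      then show ?thesis using \<open>A \<ge> 0\<close> by (simp add: r_def mult_left_le)
    qed
    define B where "B = {M..M+A} \<times> {t0..t1}"
    have B_sub: "B \<subseteq> UNIV \<times> I" using J t1 \<delta> by (auto simp: B_def)
    have "compact B" by (simp add: B_def compact_Times)
    define S where "S = {z \<in> B. l (snd z) \<le> fst z \<and> fst z \<le> M + r (snd z) \<and> - L \<le> (\<lambda>(x, t). p x t) z}"
    have "closed B" using \<open>compact B\<close> compact_imp_closed by blast
    have "S = {z \<in> B. l (snd z) \<le> fst z} \<inter> {z \<in> B. fst z \<le> M + r (snd z)} \<inter> {z \<in> B. - L \<le> (\<lambda>(x, t). p x t) z}"
      by (auto simp: S_def)
    moreover have "closed {z \<in> B. l (snd z) \<le> fst z}" "closed {z \<in> B. fst z \<le> M + r (snd z)}"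
      "closed {z \<in> B. - L \<le> (\<lambda>(x, t). p x t) z}"
      unfolding l_def r_def using \<open>closed B\<close>
      by (intro continuous_on_closed_Collect_le continuous_intros continuous_on_subset[OF cont_p B_sub]; simp)+
    ultimately have "closed S" by (simp add: closed_Int)
    then have "compact S" using \<open>compact B\<close> compact_Int_closed[of B S] by (simp add: S_def Int_absorb1 Collect_restrict)
    have x1S: "(x1, t1) \<in> S"
    proof -
      have "(C + 1) * (t1 - t0) \<le> (C + 1) * \<delta>" using t1 C by (intro mult_left_mono) auto
      then have "l t1 \<le> x1" using \<delta> x1 by (simp add: l_def)
      moreover have "r t1 \<ge> x1 - M + 2" using t1 by (intro r_ge) auto
      moreover have "r t1 \<le> A" using t1 by (intro r_le) auto
      ultimately show ?thesis using L x1 t1 by (auto simp: S_def B_def)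
    qed
    have "continuous_on B (\<lambda>z. (\<lambda>(x, t). p x t) z + c (snd z))"
      by (intro continuous_intros continuous_on_subset[OF cont_p B_sub]
          continuous_on_compose2[OF cont_c]) (use B_sub in auto)
    then have "bounded ((\<lambda>z. (\<lambda>(x, t). p x t) z + c (snd z)) ` B)"
      using \<open>compact B\<close> compact_continuous_image compact_imp_bounded by blast
    then obtain K where K: "\<And>x t. (x, t) \<in> B \<Longrightarrow> \<bar>p x t + c t\<bar> \<le> K"
      unfolding bounded_iff by fastforce
    \<comment> \<open>The weight must outweigh \<open>2 * (p + c)\<close>, which is at least
      \<open>- 2 * K\<close> on \<open>B\<close>.\<close>
    define \<Lambda> where "\<Lambda> = 2 * K + 1"
    define F where "F z = ((\<lambda>(x, t). w x t) z)\<^sup>2 * exp (- \<Lambda> * snd z)" for z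
    have "continuous_on S F" unfolding F_def
      by (intro continuous_intros continuous_on_subset[OF cont_w]) (use B_sub in \<open>auto simp: S_def\<close>)
    then obtain z where z: "z \<in> S" "\<And>y. y \<in> S \<Longrightarrow> F y \<le> F z"
      using continuous_attains_sup[OF \<open>compact S\<close>] x1S by blast
    obtain x t where xt: "z = (x, t)" by (cases z)
    have "0 < F (x1, t1)" using \<open>w x1 t1 \<noteq> 0\<close> by (simp add: F_def)
    also have "\<dots> \<le> F (x, t)" using z x1S xt by blast
    finally have wnz: "w x t \<noteq> 0" by (auto simp: F_def)
    have inS: "x \<ge> l t" "x \<le> M + r t" "p x t \<ge> - L" "t \<in> {t0..t1}" "(x, t) \<in> B" "x \<ge> M"
      using z xt by (auto simp: S_def B_def)
    have tI: "t \<in> I" "t \<in> ?J" using inS(4) t1 \<delta> J by auto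
    \<comment> \<open>The maximum is not attained at the initial time, where \<open>w\<close>
      vanishes on \<open>S\<close>; hence there is room for a step backwards.\<close>
    have "t \<noteq> t0" using w0 wnz inS(6) by blast
    then have "t > t0" using inS(4) by simp
    have neg: "((\<lambda>s. u (- s)) has_real_derivative - u') (at 0)"
      if "(u has_real_derivative u') (at 0)" for u :: "real \<Rightarrow> real" and u'
      using DERIV_mirror[of u u' 0] that by simp
    have v_low: "v x t \<ge> - C - L * (x - M)"
    proof -
      have "v M t \<ge> - C" "p M t \<ge> - L" using C(2)[of M t] tI L(1) by auto
      moreover have "min (p M t) (p x t) * (x - M) \<ge> - L * (x - M)"
        using \<open>p M t \<ge> - L\<close> inS by (intro mult_right_mono) auto
      ultimately show ?thesis using v_lower_bound[OF tI(1) inS(6)] by linarith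
    qed
    have e1: "\<forall>\<^sub>F s in at_right 0. (x - s * v x t) - l (t - s) \<ge> 0"
    proof (rule DERIV_eventually_nonneg)
      show "((\<lambda>s. (x - s * v x t) - l (t - s)) has_real_derivative - v x t + (C + 1)) (at 0)"
        unfolding l_def by (auto intro!: derivative_eq_intros)
      assume "x - 0 * v x t - l (t - 0) = 0"
      then have "x = l t" by simp
      moreover have "(C + 1) * (t - t0) \<le> (C + 1) * \<delta>" using t1 inS C by (intro mult_left_mono) auto
      \<comment> \<open>Where the left edge is active the point lies in the unit strip, so the bound
        \<open>C\<close> on \<open>v\<close> applies.\<close>
      ultimately have "x \<in> {M..M+1}" using \<delta>(3) inS by (auto simp: l_def)
      then show "- v x t + (C + 1) > 0" using C(2)[of x t] tI by auto
    qed (use inS in simp)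
    have e2: "\<forall>\<^sub>F s in at_right 0. M + r (t - s) - (x - s * v x t) \<ge> 0"
    proof (rule DERIV_eventually_nonneg)
      show "((\<lambda>s. M + r (t - s) - (x - s * v x t)) has_real_derivative (L + C) * r t + v x t) (at 0)"
        unfolding r_def by (auto intro!: derivative_eq_intros)
      assume "M + r (t - 0) - (x - 0 * v x t) = 0"
      then have "x - M = r t" by simp
      then have "v x t \<ge> - C - L * r t" using v_low by simp
      moreover have "C * r t > C * 1" using r_ge[OF inS(4)] x1 C by (intro mult_strict_left_mono) auto
      ultimately show "(L + C) * r t + v x t > 0" by (simp add: algebra_simps)
    qed (use inS in simp)
    \<comment> \<open>On \<open>p = - L\<close> the backward derivative is
      \<open>L * L / 2 - d t * L - g t\<close>, at least \<open>L - D > 0\<close>.\<close>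
    have e3: "\<forall>\<^sub>F s in at_right 0. p (x + (- s) * v x t) (t + (- s)) + L \<ge> 0"
    proof (rule DERIV_eventually_nonneg)
      show "((\<lambda>s. p (x + (- s) * v x t) (t + (- s)) + L) has_real_derivative
          - (- (p x t)\<^sup>2 / 2 - d t * p x t + g t)) (at 0)"
        using DERIV_add[OF neg[OF p_char[OF tI(1), of x]] DERIV_const[of L]] by simp
      assume "p (x + (- 0) * v x t) (t + (- 0)) + L = 0"
      then have p: "p x t = - L" by simp
      have "d t * L \<le> D * L" "g t \<le> D" using D(2)[OF tI(2)] L D(1) by (auto intro!: mult_right_mono)
      have "L * L \<ge> (2 * D + 2) * L" using L D(1) by (intro mult_right_mono) auto
      show "- (- (p x t)\<^sup>2 / 2 - d t * p x t + g t) > 0"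
      proof -
        have "- (- (p x t)\<^sup>2 / 2 - d t * p x t + g t) = (L * L) / 2 - d t * L - g t"
          by (simp add: p power2_eq_square)
        moreover have "(2 * D + 2) * L = 2 * (D * L) + 2 * L" by (simp add: algebra_simps)
        ultimately show ?thesis
          using \<open>d t * L \<le> D * L\<close> \<open>g t \<le> D\<close> \<open>L * L \<ge> (2 * D + 2) * L\<close> L D(1) by linarith
      qed
    qed (use inS in simp)
    have e4: "\<forall>\<^sub>F s in at_right 0. F (x + (- s) * v x t, t + (- s)) > F (x, t)"
    proof -
      let ?F' = "2 * w x t * ((p x t + c t) * w x t) * exp (- \<Lambda> * t) + (w x t)\<^sup>2 * (\<Lambda> * exp (- \<Lambda> * t))"
      have "((\<lambda>s. F (x + (- s) * v x t, t + (- s))) has_real_derivative ?F') (at 0)"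
        unfolding F_def using neg[OF w_char[OF tI(1), of x]]
        by (auto intro!: derivative_eq_intros simp: algebra_simps)
      moreover have "?F' > 0"
      proof -
        have "?F' = (w x t)\<^sup>2 * exp (- \<Lambda> * t) * (2 * (p x t + c t) + \<Lambda>)"
          by (simp add: power2_eq_square algebra_simps)
        moreover have "2 * (p x t + c t) + \<Lambda> > 0" using K[OF inS(5)] by (auto simp: \<Lambda>_def)
        ultimately show ?thesis using wnz by simp
      qed
      ultimately have "\<exists>e>0. \<forall>h>0. h < e \<longrightarrow>
          F (x + (- 0) * v x t, t + (- 0)) < F (x + (- (0 + h)) * v x t, t + (- (0 + h)))"
        by (rule DERIV_pos_inc_right)
      then show ?thesis unfolding eventually_at_right_field by simp
    qed
    have e5: "\<forall>\<^sub>F s in at_right 0. s < t - t0"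
      unfolding eventually_at_right_field using \<open>t > t0\<close> by (intro exI[of _ "t - t0"]) auto
    \<comment> \<open>For small positive \<open>s\<close> the shifted point would lie in
      \<open>S\<close> and exceed the maximum; \<open>at_right 0\<close> is nontrivial, so this is a
      contradiction.\<close>
    have "\<forall>\<^sub>F s in at_right (0::real). False"
      using e1 e2 e3 e4 e5 eventually_at_right_less
    proof eventually_elim
      case (elim s)
      have "l (t - s) \<ge> M" using elim(5) C by (simp add: l_def)
      moreover have "r (t - s) \<le> A" using elim(5) by (intro r_le) auto
      ultimately have "(x - s * v x t, t - s) \<in> B"
        using elim(1,2,5,6) inS(4) unfolding B_def by auto
      then have "(x - s * v x t, t - s) \<in> S" using elim(1-3) unfolding S_def by auto
      then show False using z(2)[of "(x - s * v x t, t - s)"] xt elim(4) by simp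
    qed
    then show False by (simp add: trivial_limit_at_right_real)
  qed
  then show ?thesis using \<delta>(1) by blast
qed

section \<open>Reflections and two-sided propagation\<close>

text \<open>Reversing space flips the velocity but not its \<open>x\<close>-derivative, and swaps
  \<open>mono\<close> with \<open>antimono\<close>; the disjunction in \<open>p_mono\<close> absorbs
  the swap.\<close>

lemma reflect_space:
  "transport I (\<lambda>x t. - v (- x) t) (\<lambda>x t. p (- x) t) (\<lambda>x t. w (- x) t) c d g"
proof
  have *: "continuous_on (UNIV \<times> I) (\<lambda>(x, t). f (- x) t)"
    if "continuous_on (UNIV \<times> I) (\<lambda>(x, t). f x t)" for f :: "real \<Rightarrow> real \<Rightarrow> real"
  proof -
    have "continuous_on (UNIV \<times> I) (\<lambda>z. case (- fst z, snd z) of (x, t) \<Rightarrow> f x t)"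
      by (rule continuous_on_compose2[OF that]) (auto intro!: continuous_intros)
    then show ?thesis by (simp add: case_prod_unfold)
  qed
  show "continuous_on (UNIV \<times> I) (\<lambda>(x, t). - v (- x) t)"
    using continuous_on_minus[OF *[OF cont_v]] by (simp add: case_prod_unfold)
  show "continuous_on (UNIV \<times> I) (\<lambda>(x, t). p (- x) t)"
    "continuous_on (UNIV \<times> I) (\<lambda>(x, t). w (- x) t)"
    using * cont_p cont_w by blast+
  show "((\<lambda>x. - v (- x) t) has_real_derivative p (- x) t) (at x)" if "t \<in> I" for x t
    using DERIV_minus[OF DERIV_mirror[THEN iffD1, OF v_deriv[OF that]]] by simp
  show "mono (\<lambda>x. p (- x) t) \<or> antimono (\<lambda>x. p (- x) t)" if "t \<in> I" for t
    using p_mono[OF that] by (auto simp: monotone_def)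
  show "((\<lambda>s. p (- (x + s * - v (- x) t)) (t + s)) has_real_derivative
      - (p (- x) t)\<^sup>2 / 2 - d t * p (- x) t + g t) (at 0)" if "t \<in> I" for x t
    using p_char[OF that, of "- x"] by simp
  show "((\<lambda>s. w (- (x + s * - v (- x) t)) (t + s)) has_real_derivative
      - (p (- x) t + c t) * w (- x) t) (at 0)" if "t \<in> I" for x t
    using w_char[OF that, of "- x"] by simp
qed (use open_I cont_c cont_d cont_g in auto)

text \<open>Reversing time flips \<open>v\<close>, \<open>p\<close> and the linear rates
  \<open>c\<close>, \<open>d\<close>. The quadratic term and \<open>g\<close> keep their signs,
  since \<open>p\<close> and the time derivative change sign together.\<close>

lemma reflect_time:
  "transport (uminus -` I) (\<lambda>x t. - v x (- t)) (\<lambda>x t. - p x (- t)) (\<lambda>x t. w x (- t))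
     (\<lambda>t. - c (- t)) (\<lambda>t. - d (- t)) (\<lambda>t. g (- t))"
proof
  let ?J = "uminus -` I"
  show "open ?J" using open_I by (intro open_vimage continuous_intros)
  have *: "continuous_on (UNIV \<times> ?J) (\<lambda>(x, t). f x (- t))"
    if "continuous_on (UNIV \<times> I) (\<lambda>(x, t). f x t)" for f :: "real \<Rightarrow> real \<Rightarrow> real"
  proof -
    have "continuous_on (UNIV \<times> ?J) (\<lambda>z. case (fst z, - snd z) of (x, t) \<Rightarrow> f x t)"
      by (rule continuous_on_compose2[OF that]) (auto intro!: continuous_intros)
    then show ?thesis by (simp add: case_prod_unfold)
  qed
  show "continuous_on (UNIV \<times> ?J) (\<lambda>(x, t). - v x (- t))"
    "continuous_on (UNIV \<times> ?J) (\<lambda>(x, t). - p x (- t))"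
    using continuous_on_minus[OF *[OF cont_v]] continuous_on_minus[OF *[OF cont_p]]
    by (simp_all add: case_prod_unfold)
  show "continuous_on (UNIV \<times> ?J) (\<lambda>(x, t). w x (- t))" using * cont_w by blast
  show "continuous_on ?J (\<lambda>t. - c (- t))" "continuous_on ?J (\<lambda>t. - d (- t))"
    "continuous_on ?J (\<lambda>t. g (- t))"
    by (intro continuous_intros continuous_on_compose2[OF cont_c]
        continuous_on_compose2[OF cont_d] continuous_on_compose2[OF cont_g]; auto)+
  show "((\<lambda>x. - v x (- t)) has_real_derivative - p x (- t)) (at x)" if "t \<in> ?J" for x t
    using v_deriv[of "- t"] that by (auto intro!: derivative_intros)
  show "mono (\<lambda>x. - p x (- t)) \<or> antimono (\<lambda>x. - p x (- t))" if "t \<in> ?J" for t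
    using p_mono[of "- t"] that by (auto simp: monotone_def)
  show "((\<lambda>s. - p (x + s * - v x (- t)) (- (t + s))) has_real_derivative
      - (- p x (- t))\<^sup>2 / 2 - - d (- t) * - p x (- t) + g (- t)) (at 0)" if "t \<in> ?J" for x t
  proof -
    have "((\<lambda>s. p (x + s * v x (- t)) (- t + s)) has_real_derivative
        - (p x (- t))\<^sup>2 / 2 - d (- t) * p x (- t) + g (- t)) (at (- 0))"
      using p_char[of "- t" x] that by simp
    from DERIV_minus[OF DERIV_mirror[THEN iffD1, OF this]] show ?thesis by (simp add: algebra_simps)
  qed
  show "((\<lambda>s. w (x + s * - v x (- t)) (- (t + s))) has_real_derivative
      - (- p x (- t) + - c (- t)) * w x (- t)) (at 0)" if "t \<in> ?J" for x t
  proof -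
    have "((\<lambda>s. w (x + s * v x (- t)) (- t + s)) has_real_derivative
        - (p x (- t) + c (- t)) * w x (- t)) (at (- 0))"
      using w_char[of "- t" x] that by simp
    from DERIV_mirror[THEN iffD1, OF this] show ?thesis by (simp add: algebra_simps)
  qed
qed

text \<open>The forward statement covers times after \<open>t0\<close>; for the time-reflected
  system at \<open>- t0\<close> it covers times before.\<close>

lemma vanishes_right:
  assumes "t0 \<in> I" and w0: "\<And>x. x \<ge> M \<Longrightarrow> w x t0 = 0"
  shows "\<exists>\<delta>>0. \<forall>t. \<bar>t - t0\<bar> \<le> \<delta> \<longrightarrow> (\<forall>x\<ge>M+1. w x t = 0)"
proof -
  interpret T: transport "uminus -` I" "\<lambda>x t. - v x (- t)" "\<lambda>x t. - p x (- t)" "\<lambda>x t. w x (- t)"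
    "\<lambda>t. - c (- t)" "\<lambda>t. - d (- t)" "\<lambda>t. g (- t)" by (rule reflect_time)
  obtain \<delta>1 where \<delta>1: "\<delta>1 > 0" "\<forall>t\<in>{t0..t0+\<delta>1}. \<forall>x\<ge>M+1. w x t = 0"
    using vanishes_right_forward[of t0 M] assms by blast
  obtain \<delta>2 where \<delta>2: "\<delta>2 > 0" "\<forall>t\<in>{-t0..-t0+\<delta>2}. \<forall>x\<ge>M+1. w x (- t) = 0"
    using T.vanishes_right_forward[of "- t0" M] assms by auto
  have "w x t = 0" if "\<bar>t - t0\<bar> \<le> min \<delta>1 \<delta>2" "x \<ge> M + 1" for x t
  proof (cases "t \<ge> t0")
    case True
    then show ?thesis using \<delta>1(2) that by auto
  next
    case False
    then have "- t \<in> {-t0..-t0+\<delta>2}" using that by auto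
    then show ?thesis using \<delta>2(2) that(2) by fastforce
  qed
  then show ?thesis using \<delta>1(1) \<delta>2(1) by (intro exI[of _ "min \<delta>1 \<delta>2"]) auto
qed

text \<open>Space reflection adds the left half-line. This is the locally uniform bound on the
  support of \<open>w\<close>.\<close>

lemma vanishes_outside:
  assumes "t0 \<in> I" and w0: "\<And>x. \<bar>x\<bar> \<ge> M \<Longrightarrow> w x t0 = 0" and "M \<ge> 0"
  shows "\<exists>\<delta>>0. \<forall>t. \<bar>t - t0\<bar> \<le> \<delta> \<longrightarrow> (\<forall>x. \<bar>x\<bar> \<ge> M + 1 \<longrightarrow> w x t = 0)"
proof -
  interpret R: transport I "\<lambda>x t. - v (- x) t" "\<lambda>x t. p (- x) t" "\<lambda>x t. w (- x) t" c d g
    by (rule reflect_space)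
  obtain \<delta>1 where \<delta>1: "\<delta>1 > 0" "\<And>t x. \<bar>t - t0\<bar> \<le> \<delta>1 \<Longrightarrow> x \<ge> M + 1 \<Longrightarrow> w x t = 0"
    using vanishes_right[of t0 M] assms by auto
  obtain \<delta>2 where \<delta>2: "\<delta>2 > 0" "\<And>t x. \<bar>t - t0\<bar> \<le> \<delta>2 \<Longrightarrow> x \<ge> M + 1 \<Longrightarrow> w (- x) t = 0"
    using R.vanishes_right[of t0 M] assms by auto
  have "w x t = 0" if "\<bar>t - t0\<bar> \<le> min \<delta>1 \<delta>2" "\<bar>x\<bar> \<ge> M + 1" for x t
    using \<delta>1(2)[of t x] \<delta>2(2)[of t "- x"] that by (cases "x \<ge> 0") auto
  then show ?thesis using \<delta>1(1) \<delta>2(1) by (intro exI[of _ "min \<delta>1 \<delta>2"]) auto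
qed

end

subsection \<open>The jump law\<close>

lemma
  fixes f u :: "real \<Rightarrow> real"
  assumes "open I" and f: "smooth_on f UNIV" and u: "smooth_on u I"
  shows DERIV_smooth_compose:
      "\<And>t. t \<in> I \<Longrightarrow> ((\<lambda>t. f (u t)) has_real_derivative deriv f (u t) * deriv u t) (at t)"
    and continuous_on_smooth_compose: "continuous_on I (\<lambda>t. f (u t))"
    and continuous_on_deriv_smooth_compose: "continuous_on I (\<lambda>t. deriv f (u t) * deriv u t)"
proof -
  have comp: "continuous_on I (\<lambda>t. h (u t))" if "smooth_on h UNIV" for h :: "real \<Rightarrow> real"
    by (rule continuous_on_compose2[OF smooth_on_continuous[OF that] smooth_on_continuous[OF u]]) simp
  show "((\<lambda>t. f (u t)) has_real_derivative deriv f (u t) * deriv u t) (at t)" if "t \<in> I" for t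
    using DERIV_chain2[OF smooth_on_DERIV[OF f] smooth_on_DERIV[OF u that]] by simp
  show "continuous_on I (\<lambda>t. f (u t))" using comp f by blast
  show "continuous_on I (\<lambda>t. deriv f (u t) * deriv u t)"
    using comp[OF smooth_on_deriv[OF open_UNIV f]] smooth_on_continuous[OF smooth_on_deriv[OF \<open>open I\<close> u]]
    by (intro continuous_intros)
qed

lemma smooth_on_continuous_slice:
  fixes f :: "real \<Rightarrow> real \<Rightarrow> real"
  assumes "smooth_on (\<lambda>(x, t). f x t) (UNIV \<times> I)"
  shows "continuous_on I (f x)"
proof -
  have "continuous_on I (\<lambda>t. case (x, t) of (x, t) \<Rightarrow> f x t)"
    by (rule continuous_on_compose2[OF smooth_on_continuous[OF assms]]) (auto intro!: continuous_intros)
  then show ?thesis by simp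
qed

lemma jump_eq:
  assumes "(f \<longlongrightarrow> l) at_top" "(f \<longlongrightarrow> m) at_bot"
  shows "has_jump f" "jump f = l - m"
  using assms tendsto_Lim[of at_top f l] tendsto_Lim[of at_bot f m] by (auto simp: has_jump_def jump_def)

section \<open>The system with abstract coefficients\<close>

text \<open>In the application \<open>A\<close> is \<open>b'R\<close>, \<open>h\<close> is
  \<open>(qR t)\<^sup>2 * bR t\<close>, and \<open>n\<close> clears the denominator of the second
  equation. The identity \<open>h' = 2 * c * h\<close> is what couples the two equations:
  \<open>c\<close> is half the logarithmic derivative of that \<open>h\<close>.\<close>

locale coupled_system =
  fixes I :: "real set" and A A' n n' h h' c :: "real \<Rightarrow> real" and \<phi> \<psi> :: "real \<Rightarrow> real \<Rightarrow> real"
  assumes open_I: "open I"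
    and A_deriv: "\<And>t. t \<in> I \<Longrightarrow> (A has_real_derivative A' t) (at t)"
    and n_deriv: "\<And>t. t \<in> I \<Longrightarrow> (n has_real_derivative n' t) (at t)"
    and h_deriv: "\<And>t. t \<in> I \<Longrightarrow> (h has_real_derivative h' t) (at t)"
    and cont_A': "continuous_on I A'" and cont_n': "continuous_on I n'" and cont_c: "continuous_on I c"
    and A_nz: "\<And>t. t \<in> I \<Longrightarrow> A t \<noteq> 0" and n_nz: "\<And>t. t \<in> I \<Longrightarrow> n t \<noteq> 0"
    and h': "\<And>t. t \<in> I \<Longrightarrow> h' t = 2 * c t * h t"
    and \<phi>: "smooth_on (\<lambda>(x, t). \<phi> x t) (UNIV \<times> I)"
    and \<psi>: "smooth_on (\<lambda>(x, t). \<psi> x t) (UNIV \<times> I)"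
    and \<psi>_eq: "\<And>x t. t \<in> I \<Longrightarrow>
      D\<theta> (\<lambda>x t. Dt \<psi> x t + A t * \<phi> x t * D\<theta> \<psi> x t + c t * \<psi> x t) x t = 0"
    and \<phi>_eq: "\<And>x t. t \<in> I \<Longrightarrow> n t * D\<theta> (D\<theta> \<phi>) x t = h t * (D\<theta> \<psi> x t)\<^sup>2"
begin

abbreviation "w \<equiv> D\<theta> \<psi>"

lemmas smooth_\<phi>_x = smooth_on_D\<theta>[OF open_I \<phi>]
lemmas smooth_\<phi>_xx = smooth_on_D\<theta>[OF open_I smooth_\<phi>_x]
lemmas smooth_\<phi>_xt = smooth_on_Dt[OF open_I smooth_\<phi>_x]
lemmas smooth_w = smooth_on_D\<theta>[OF open_I \<psi>]

text \<open>Expanding the outer derivative in \<open>\<psi>_eq\<close> and exchanging it with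
  \<open>Dt\<close> leaves a transport law for \<open>w\<close> in which \<open>\<psi>\<close>
  itself no longer occurs.\<close>

lemma w_t:
  assumes "t \<in> I"
  shows "Dt w x t + A t * (D\<theta> \<phi> x t * w x t + \<phi> x t * D\<theta> w x t) + c t * w x t = 0"
proof -
  have "((\<lambda>x. Dt \<psi> x t + A t * \<phi> x t * w x t + c t * \<psi> x t) has_real_derivative
      D\<theta> (Dt \<psi>) x t + A t * (D\<theta> \<phi> x t * w x t + \<phi> x t * D\<theta> w x t) + c t * w x t) (at x)"
    using has_D\<theta>[OF smooth_on_Dt[OF open_I \<psi>] assms, of x] has_D\<theta>[OF \<phi> assms, of x]
      has_D\<theta>[OF \<psi> assms, of x] has_D\<theta>[OF smooth_w assms, of x]
    by (auto intro!: derivative_eq_intros simp: algebra_simps)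
  from DERIV_imp_deriv[OF this] show ?thesis
    using \<psi>_eq[OF assms, of x] D\<theta>_Dt_commute[OF open_I \<psi> assms] by (simp add: D\<theta>_def[of "\<lambda>x t. _ x t + _ x t"])
qed

lemma \<phi>_eq_x:
  assumes "t \<in> I"
  shows "n t * D\<theta> (D\<theta> (D\<theta> \<phi>)) x t = 2 * h t * w x t * D\<theta> w x t"
proof -
  have "((\<lambda>x. n t * D\<theta> (D\<theta> \<phi>) x t) has_real_derivative n t * D\<theta> (D\<theta> (D\<theta> \<phi>)) x t) (at x)"
    using has_D\<theta>[OF smooth_\<phi>_xx assms, of x] by (auto intro!: derivative_eq_intros)
  moreover have "((\<lambda>x. h t * (w x t)\<^sup>2) has_real_derivative 2 * h t * w x t * D\<theta> w x t) (at x)"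
    using has_D\<theta>[OF smooth_w assms, of x] by (auto intro!: derivative_eq_intros)
  ultimately show ?thesis using \<phi>_eq[OF assms] DERIV_unique by simp
qed

lemma \<phi>_eq_t:
  assumes "t \<in> I"
  shows "n' t * D\<theta> (D\<theta> \<phi>) x t + n t * D\<theta> (Dt (D\<theta> \<phi>)) x t = h' t * (w x t)\<^sup>2 + 2 * h t * w x t * Dt w x t"
proof -
  have "((\<lambda>t. n t * D\<theta> (D\<theta> \<phi>) x t) has_real_derivative
      n' t * D\<theta> (D\<theta> \<phi>) x t + n t * Dt (D\<theta> (D\<theta> \<phi>)) x t) (at t)"
    using has_Dt[OF smooth_\<phi>_xx assms, of x] n_deriv[OF assms] by (auto intro!: derivative_eq_intros)
  moreover have "((\<lambda>t. h t * (w x t)\<^sup>2) has_real_derivative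
      h' t * (w x t)\<^sup>2 + 2 * h t * w x t * Dt w x t) (at t)"
    using has_Dt[OF smooth_w assms, of x] h_deriv[OF assms] by (auto intro!: derivative_eq_intros)
  \<comment> \<open>Both sides of \<open>\<phi>_eq\<close> agree at all times in the open set
    \<open>I\<close>, so their time derivatives agree.\<close>
  then have "((\<lambda>t. n t * D\<theta> (D\<theta> \<phi>) x t) has_real_derivative
      h' t * (w x t)\<^sup>2 + 2 * h t * w x t * Dt w x t) (at t)"
    by (rule has_field_derivative_transform_within_open[OF _ open_I assms]) (simp add: \<phi>_eq)
  ultimately show ?thesis
    using DERIV_unique D\<theta>_Dt_commute[OF open_I smooth_\<phi>_x assms] by metis
qed

definition G :: "real \<Rightarrow> real \<Rightarrow> real" where
  "G x t = n' t * D\<theta> \<phi> x t + n t * Dt (D\<theta> \<phi>) x t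
     + n t * A t * (\<phi> x t * D\<theta> (D\<theta> \<phi>) x t + (D\<theta> \<phi> x t)\<^sup>2 / 2)"

text \<open>The \<open>x\<close>-derivative of \<open>G\<close> is \<open>2 * h * w\<close> times
  the left side of \<open>w_t\<close>; the identity \<open>h' = 2 * c * h\<close> supplies the term
  \<open>c * w\<close>.\<close>

lemma G_const:
  assumes "t \<in> I"
  shows "G x t = G y t"
proof -
  have "((\<lambda>x. G x t) has_real_derivative 0) (at x)" for x
  proof -
    let ?p = "D\<theta> \<phi> x t" and ?q = "D\<theta> (D\<theta> \<phi>) x t" and ?r = "D\<theta> (D\<theta> (D\<theta> \<phi>)) x t"
    have "((\<lambda>x. G x t) has_real_derivative n' t * ?q + n t * D\<theta> (Dt (D\<theta> \<phi>)) x t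
        + n t * A t * (2 * ?p * ?q + \<phi> x t * ?r)) (at x)"
      unfolding G_def
      using has_D\<theta>[OF \<phi> assms, of x] has_D\<theta>[OF smooth_\<phi>_x assms, of x]
        has_D\<theta>[OF smooth_\<phi>_xx assms, of x] has_D\<theta>[OF smooth_\<phi>_xt assms, of x]
      by (auto intro!: derivative_eq_intros simp: algebra_simps)
    moreover have "n' t * ?q + n t * D\<theta> (Dt (D\<theta> \<phi>)) x t + n t * A t * (2 * ?p * ?q + \<phi> x t * ?r) = 0"
    proof -
      have "n' t * ?q + n t * D\<theta> (Dt (D\<theta> \<phi>)) x t + n t * A t * (2 * ?p * ?q + \<phi> x t * ?r)
        = (n' t * ?q + n t * D\<theta> (Dt (D\<theta> \<phi>)) x t) + A t * (2 * ?p * (n t * ?q) + \<phi> x t * (n t * ?r))"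
        by (simp add: algebra_simps)
      also have "\<dots> = 2 * h t * w x t
          * (Dt w x t + A t * (D\<theta> \<phi> x t * w x t + \<phi> x t * D\<theta> w x t) + c t * w x t)"
        unfolding \<phi>_eq_t[OF assms] \<phi>_eq[OF assms] \<phi>_eq_x[OF assms] h'[OF assms]
        by (simp add: algebra_simps power2_eq_square)
      finally show ?thesis using w_t[OF assms] by simp
    qed
    ultimately show ?thesis by simp
  qed
  then show ?thesis by (rule DERIV_isconst_all[rule_format])
qed

text \<open>Multiplied by \<open>A / n\<close>, the identity \<open>G x t = G 0 t\<close> becomes
  the Riccati equation for \<open>A * D\<theta> \<phi>\<close> along the speed
  \<open>A * \<phi>\<close>, with a source depending on time only.\<close>

sublocale transport I "\<lambda>x t. A t * \<phi> x t" "\<lambda>x t. A t * D\<theta> \<phi> x t" w c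
  "\<lambda>t. n' t / n t - A' t / A t" "\<lambda>t. A t / n t * G 0 t"
proof
  have cont_A: "continuous_on I A" and cont_n: "continuous_on I n"
    using A_deriv n_deriv by (meson DERIV_continuous_on has_field_derivative_at_within)+
  have *: "continuous_on (UNIV \<times> I) (\<lambda>(x, t). A t * f x t)"
    if "smooth_on (\<lambda>(x, t). f x t) (UNIV \<times> I)" for f
    using smooth_on_continuous[OF that] unfolding case_prod_unfold
    by (intro continuous_intros continuous_on_compose2[OF cont_A]) auto
  show "continuous_on (UNIV \<times> I) (\<lambda>(x, t). A t * \<phi> x t)"
    "continuous_on (UNIV \<times> I) (\<lambda>(x, t). A t * D\<theta> \<phi> x t)"
    using * \<phi> smooth_\<phi>_x by blast+
  show "continuous_on (UNIV \<times> I) (\<lambda>(x, t). w x t)" by (rule smooth_on_continuous[OF smooth_w])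
  show "continuous_on I (\<lambda>t. n' t / n t - A' t / A t)"
    by (intro continuous_intros cont_A cont_n cont_A' cont_n') (use A_nz n_nz in auto)
  show "continuous_on I (\<lambda>t. A t / n t * G 0 t)" unfolding G_def
    by (intro continuous_intros cont_A cont_n cont_n' smooth_on_continuous_slice[OF \<phi>]
      smooth_on_continuous_slice[OF smooth_\<phi>_x] smooth_on_continuous_slice[OF smooth_\<phi>_xx]
      smooth_on_continuous_slice[OF smooth_\<phi>_xt]) (use n_nz in auto)
  fix x t assume t: "t \<in> I"
  show "((\<lambda>x. A t * \<phi> x t) has_real_derivative A t * D\<theta> \<phi> x t) (at x)"
    using has_D\<theta>[OF \<phi> t, of x] by (auto intro!: derivative_eq_intros)
  let ?v = "A t * \<phi> x t"
  have "((\<lambda>s. A (t + s)) has_real_derivative A' t) (at 0)"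
    using DERIV_shift[of A "A' t" 0 t] A_deriv[OF t] by (simp add: add.commute)
  then have "((\<lambda>s. A (t + s) * D\<theta> \<phi> (x + s * ?v) (t + s)) has_real_derivative
      A' t * D\<theta> \<phi> x t + A t * (?v * D\<theta> (D\<theta> \<phi>) x t + Dt (D\<theta> \<phi>) x t)) (at 0)"
    using DERIV_along_line[OF smooth_\<phi>_x t, of x ?v] by (auto intro!: derivative_eq_intros)
  moreover have "A' t * D\<theta> \<phi> x t + A t * (?v * D\<theta> (D\<theta> \<phi>) x t + Dt (D\<theta> \<phi>) x t)
      = - (A t * D\<theta> \<phi> x t)\<^sup>2 / 2 - (n' t / n t - A' t / A t) * (A t * D\<theta> \<phi> x t) + A t / n t * G 0 t"
    unfolding G_const[OF t, of 0 x] unfolding G_def using A_nz[OF t] n_nz[OF t]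
    by (simp add: field_simps power2_eq_square)
  ultimately show "((\<lambda>s. A (t + s) * D\<theta> \<phi> (x + s * ?v) (t + s)) has_real_derivative
      - (A t * D\<theta> \<phi> x t)\<^sup>2 / 2 - (n' t / n t - A' t / A t) * (A t * D\<theta> \<phi> x t) + A t / n t * G 0 t) (at 0)"
    by simp
  have "?v * D\<theta> w x t + Dt w x t = - (A t * D\<theta> \<phi> x t + c t) * w x t"
    using w_t[OF t, of x] by (simp add: algebra_simps)
  then show "((\<lambda>s. w (x + s * ?v) (t + s)) has_real_derivative
      - (A t * D\<theta> \<phi> x t + c t) * w x t) (at 0)"
    using DERIV_along_line[OF smooth_w t, of x ?v] by simp
next
  fix t assume t: "t \<in> I"
  \<comment> \<open>\<open>k * w\<^sup>2\<close> is the slope of \<open>p\<close> in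
    \<open>x\<close>, hence of one sign for fixed \<open>t\<close>; the sign of \<open>k\<close> is
    not prescribed, so both cases occur.\<close>
  define k where "k = A t * h t / n t"
  have der: "((\<lambda>x. A t * D\<theta> \<phi> x t) has_real_derivative k * (w x t)\<^sup>2) (at x)" for x
  proof -
    have "A t * D\<theta> (D\<theta> \<phi>) x t = k * (w x t)\<^sup>2"
      using \<phi>_eq[OF t, of x] n_nz[OF t] by (simp add: k_def field_simps)
    then show ?thesis using has_D\<theta>[OF smooth_\<phi>_x t, of x]
      by (auto intro!: derivative_eq_intros simp: mult.commute)
  qed
  show "mono (\<lambda>x. A t * D\<theta> \<phi> x t) \<or> antimono (\<lambda>x. A t * D\<theta> \<phi> x t)"
  proof (cases "k \<ge> 0")
    case True
    have "mono (\<lambda>x. A t * D\<theta> \<phi> x t)"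
    proof (rule monoI)
      fix x y :: real assume "x \<le> y"
      moreover have "\<exists>l. ((\<lambda>x. A t * D\<theta> \<phi> x t) has_real_derivative l) (at z) \<and> 0 \<le> l" for z
        using der[of z] True by (meson mult_nonneg_nonneg zero_le_power2)
      ultimately show "A t * D\<theta> \<phi> x t \<le> A t * D\<theta> \<phi> y t"
        by (rule DERIV_nonneg_imp_nondecreasing)
    qed
    then show ?thesis ..
  next
    case False
    have "antimono (\<lambda>x. A t * D\<theta> \<phi> x t)"
    proof (rule antimonoI)
      fix x y :: real assume "x \<le> y"
      moreover have "\<exists>l. ((\<lambda>x. A t * D\<theta> \<phi> x t) has_real_derivative l) (at z) \<and> l \<le> 0" for z
        using der[of z] False by (meson linear mult_nonpos_nonneg zero_le_power2)
      ultimately show "A t * D\<theta> \<phi> y t \<le> A t * D\<theta> \<phi> x t"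
        by (rule DERIV_nonpos_imp_nonincreasing)
    qed
    then show ?thesis ..
  qed
qed (use open_I cont_c in auto)

section \<open>Jumps of the \<theta>-derivative of \<phi>\<close>

text \<open>The second derivative vanishes where \<open>w\<close> does. The half-lines are treated
  separately: the difference of the two constants is the jump.\<close>

lemma \<phi>_x_eventually_const:
  assumes "t \<in> I" and w0: "\<And>x. \<bar>x\<bar> \<ge> N \<Longrightarrow> w x t = 0" and "N \<ge> 0"
  shows "x \<ge> N \<Longrightarrow> D\<theta> \<phi> x t = D\<theta> \<phi> N t" and "x \<le> - N \<Longrightarrow> D\<theta> \<phi> x t = D\<theta> \<phi> (- N) t"
    and "\<bar>x\<bar> \<ge> N \<Longrightarrow> D\<theta> (D\<theta> \<phi>) x t = 0"
proof -
  show \<phi>_xx: "D\<theta> (D\<theta> \<phi>) x t = 0" if "\<bar>x\<bar> \<ge> N" for x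
    using \<phi>_eq[OF \<open>t \<in> I\<close>, of x] w0[OF that] n_nz[OF \<open>t \<in> I\<close>] by simp
  note der = has_D\<theta>[OF smooth_\<phi>_x \<open>t \<in> I\<close>]
  show "D\<theta> \<phi> x t = D\<theta> \<phi> N t" if "x \<ge> N"
  proof (rule has_field_derivative_zero_constant[of "{N..}" "\<lambda>x. D\<theta> \<phi> x t", THEN exE])
    show "((\<lambda>x. D\<theta> \<phi> x t) has_real_derivative 0) (at y within {N..})" if "y \<in> {N..}" for y
      using der[of y] \<phi>_xx[of y] that \<open>N \<ge> 0\<close> by (auto intro: has_field_derivative_at_within)
  qed (use that in \<open>auto simp: convex_real_interval\<close>)
  show "D\<theta> \<phi> x t = D\<theta> \<phi> (- N) t" if "x \<le> - N"
  proof (rule has_field_derivative_zero_constant[of "{..-N}" "\<lambda>x. D\<theta> \<phi> x t", THEN exE])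
    show "((\<lambda>x. D\<theta> \<phi> x t) has_real_derivative 0) (at y within {..-N})" if "y \<in> {..-N}" for y
      using der[of y] \<phi>_xx[of y] that \<open>N \<ge> 0\<close> by (auto intro: has_field_derivative_at_within)
  qed (use that in \<open>auto simp: convex_real_interval\<close>)
qed

lemma \<phi>_x_limits:
  assumes "t \<in> I" and w0: "\<And>x. \<bar>x\<bar> \<ge> N \<Longrightarrow> w x t = 0" and "N \<ge> 0"
  shows "((\<lambda>x. D\<theta> \<phi> x t) \<longlongrightarrow> D\<theta> \<phi> N t) at_top" "((\<lambda>x. D\<theta> \<phi> x t) \<longlongrightarrow> D\<theta> \<phi> (- N) t) at_bot"
proof -
  note const = \<phi>_x_eventually_const(1,2)[OF assms]
  have "\<forall>\<^sub>F x in at_top. D\<theta> \<phi> x t = D\<theta> \<phi> N t"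
    using eventually_ge_at_top[of N] by (rule eventually_mono) (rule const)
  then show "((\<lambda>x. D\<theta> \<phi> x t) \<longlongrightarrow> D\<theta> \<phi> N t) at_top" by (rule tendsto_eventually)
  have "\<forall>\<^sub>F x in at_bot. D\<theta> \<phi> x t = D\<theta> \<phi> (- N) t"
    using eventually_le_at_bot[of "- N"] by (rule eventually_mono) (rule const)
  then show "((\<lambda>x. D\<theta> \<phi> x t) \<longlongrightarrow> D\<theta> \<phi> (- N) t) at_bot" by (rule tendsto_eventually)
qed

text \<open>One \<open>N\<close> bounds the supports for all times near \<open>t\<close>, so the
  jump is a difference of values at the fixed points \<open>N\<close> and \<open>- N\<close> and can
  be differentiated in time. Then \<open>G N t = G (- N) t\<close> evaluates the result.\<close>

lemma jump_law:
  assumes supp: "\<And>t. t \<in> I \<Longrightarrow> bounded {x. w x t \<noteq> 0}" and "t \<in> I"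
  shows "has_jump (\<lambda>x. D\<theta> \<phi> x t)" and "has_jump (\<lambda>x. (D\<theta> \<phi> x t)\<^sup>2)"
    and "((\<lambda>s. n s * jump (\<lambda>x. D\<theta> \<phi> x s)) has_real_derivative
      - (n t * A t / 2) * jump (\<lambda>x. (D\<theta> \<phi> x t)\<^sup>2)) (at t)"
proof -
  obtain M where M: "M > 0" "\<And>x. w x t \<noteq> 0 \<Longrightarrow> \<bar>x\<bar> \<le> M"
    using supp[OF \<open>t \<in> I\<close>] unfolding bounded_pos by auto
  have "w x t = 0" if "\<bar>x\<bar> \<ge> M + 1" for x using M(2)[of x] that by fastforce
  then obtain \<delta> where \<delta>: "\<delta> > 0" "\<And>s x. \<bar>s - t\<bar> \<le> \<delta> \<Longrightarrow> \<bar>x\<bar> \<ge> M + 1 + 1 \<Longrightarrow> w x s = 0"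
    using vanishes_outside[OF \<open>t \<in> I\<close>, of "M + 1"] M(1) by auto
  \<comment> \<open>One unit passes from the bound \<open>M\<close> to points where \<open>w\<close>
    surely vanishes; the other is the loss in \<open>vanishes_outside\<close>.\<close>
  define N where "N = M + 2"
  have N: "N \<ge> 0" "\<And>s x. \<bar>s - t\<bar> \<le> \<delta> \<Longrightarrow> \<bar>x\<bar> \<ge> N \<Longrightarrow> w x s = 0"
    using \<delta> M by (auto simp: N_def)
  define U where "U = I \<inter> ball t \<delta>"
  have U: "open U" "t \<in> U" "\<And>s. s \<in> U \<Longrightarrow> s \<in> I \<and> \<bar>s - t\<bar> \<le> \<delta>"
    using open_I \<open>t \<in> I\<close> \<delta>(1) by (auto simp: U_def dist_real_def)
  have lim: "((\<lambda>x. D\<theta> \<phi> x s) \<longlongrightarrow> D\<theta> \<phi> N s) at_top" "((\<lambda>x. D\<theta> \<phi> x s) \<longlongrightarrow> D\<theta> \<phi> (- N) s) at_bot"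
    if "s \<in> U" for s
    using \<phi>_x_limits[of s N] N U(3)[OF that] by auto
  note jump = jump_eq[OF lim] and jump2 = jump_eq[OF lim[THEN tendsto_power]]
  show "has_jump (\<lambda>x. D\<theta> \<phi> x t)" "has_jump (\<lambda>x. (D\<theta> \<phi> x t)\<^sup>2)"
    by (rule jump(1)[OF U(2) U(2)], rule jump2(1)[OF U(2) U(2)])
  have "((\<lambda>s. n s * (D\<theta> \<phi> N s - D\<theta> \<phi> (- N) s)) has_real_derivative
      n' t * (D\<theta> \<phi> N t - D\<theta> \<phi> (- N) t) + n t * (Dt (D\<theta> \<phi>) N t - Dt (D\<theta> \<phi>) (- N) t)) (at t)"
    using n_deriv[OF \<open>t \<in> I\<close>] has_Dt[OF smooth_\<phi>_x \<open>t \<in> I\<close>]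
    by (auto intro!: derivative_eq_intros)
  moreover have "n' t * (D\<theta> \<phi> N t - D\<theta> \<phi> (- N) t) + n t * (Dt (D\<theta> \<phi>) N t - Dt (D\<theta> \<phi>) (- N) t)
      = - (n t * A t / 2) * jump (\<lambda>x. (D\<theta> \<phi> x t)\<^sup>2)"
  proof -
    have "D\<theta> (D\<theta> \<phi>) x t = 0" if "\<bar>x\<bar> \<ge> N" for x
      using \<phi>_x_eventually_const(3)[of t N x] N U(2,3) \<open>t \<in> I\<close> that by auto
    \<comment> \<open>\<open>\<phi>\<close> may differ at the two points; its product with the
      second derivative drops out of \<open>G\<close> because the latter is zero there.\<close>
    then have \<phi>_xx: "D\<theta> (D\<theta> \<phi>) N t = 0" "D\<theta> (D\<theta> \<phi>) (- N) t = 0" using N(1) by auto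
    have J: "jump (\<lambda>x. (D\<theta> \<phi> x t)\<^sup>2) = (D\<theta> \<phi> N t)\<^sup>2 - (D\<theta> \<phi> (- N) t)\<^sup>2"
      by (rule jump2(2)[OF U(2) U(2)])
    show ?thesis unfolding J
      using G_const[OF \<open>t \<in> I\<close>, of N "- N"] \<phi>_xx by (simp add: G_def field_simps)
  qed
  ultimately have "((\<lambda>s. n s * (D\<theta> \<phi> N s - D\<theta> \<phi> (- N) s)) has_real_derivative
      - (n t * A t / 2) * jump (\<lambda>x. (D\<theta> \<phi> x t)\<^sup>2)) (at t)" by simp
  then show "((\<lambda>s. n s * jump (\<lambda>x. D\<theta> \<phi> x s)) has_real_derivative
      - (n t * A t / 2) * jump (\<lambda>x. (D\<theta> \<phi> x t)\<^sup>2)) (at t)"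
    by (rule has_field_derivative_transform_within_open[OF _ U(1,2)]) (simp add: jump(2))
qed

end

section \<open>Specialisation to the given coefficients\<close>

theorem proposition1:
  fixes a b q :: "real \<Rightarrow> real"
    and \<phi>R :: "real \<Rightarrow> real"
    and I :: "real set"
    and aR bR qR b'R bRt qRt :: "real \<Rightarrow> real"
    and \<phi>2 \<psi>1 :: "real \<Rightarrow> real \<Rightarrow> real"
  assumes I: "open I" "is_interval I"
    and a: "smooth_on a UNIV" "\<And>\<phi>. a \<phi> > 0"
    and b: "smooth_on b UNIV" "\<And>\<phi>. b \<phi> > 0"
    and q: "smooth_on q UNIV"
    and \<phi>R: "smooth_on \<phi>R I"
    and aR: "aR = (\<lambda>t. a (\<phi>R t))"
    and bR: "bR = (\<lambda>t. b (\<phi>R t))"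
    and qR: "qR = (\<lambda>t. q (\<phi>R t))"
    and b'R: "b'R = (\<lambda>t. deriv b (\<phi>R t))"
    and bRt: "bRt = (\<lambda>t. deriv bR t)"
    and qRt: "qRt = (\<lambda>t. deriv qR t)"
    and nondegenerate: "\<And>t. t \<in> I \<Longrightarrow> aR t \<noteq> bR t" "\<And>t. t \<in> I \<Longrightarrow> b'R t \<noteq> 0"
      "\<And>t. t \<in> I \<Longrightarrow> qR t \<noteq> 0"
    and \<phi>2: "smooth_on (\<lambda>(\<theta>, t). \<phi>2 \<theta> t) (UNIV \<times> I)"
    and \<psi>1: "smooth_on (\<lambda>(\<theta>, t). \<psi>1 \<theta> t) (UNIV \<times> I)"
    and eq1: "\<And>\<theta> t. t \<in> I \<Longrightarrow>
      D\<theta> (\<lambda>\<theta> t. Dt \<psi>1 \<theta> t + b'R t * \<phi>2 \<theta> t * D\<theta> \<psi>1 \<theta> t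
                 + (bRt t / (2 * bR t) + qRt t / qR t) * \<psi>1 \<theta> t) \<theta> t = 0"
    and eq2: "\<And>\<theta> t. t \<in> I \<Longrightarrow>
      D\<theta> (D\<theta> \<phi>2) \<theta> t
        = ((qR t)\<^sup>2 * bR t * b'R t / ((aR t)\<^sup>2 - (bR t)\<^sup>2)) * (D\<theta> \<psi>1 \<theta> t)\<^sup>2"
    and supp: "\<And>t. t \<in> I \<Longrightarrow> compact (closure {\<theta>. D\<theta> \<psi>1 \<theta> t \<noteq> 0})"
  shows "\<forall>t\<in>I.
      has_jump (\<lambda>\<theta>. D\<theta> \<phi>2 \<theta> t) \<and> has_jump (\<lambda>\<theta>. (D\<theta> \<phi>2 \<theta> t)\<^sup>2) \<and>
      (\<lambda>s. (((aR s)\<^sup>2 - (bR s)\<^sup>2) / b'R s) * jump (\<lambda>\<theta>. D\<theta> \<phi>2 \<theta> s)) differentiable (at t) \<and>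
      deriv (\<lambda>s. (((aR s)\<^sup>2 - (bR s)\<^sup>2) / b'R s) * jump (\<lambda>\<theta>. D\<theta> \<phi>2 \<theta> s)) t
        + (((aR t)\<^sup>2 - (bR t)\<^sup>2) / 2) * jump (\<lambda>\<theta>. (D\<theta> \<phi>2 \<theta> t)\<^sup>2) = 0"
proof -
  \<comment> \<open>\<open>n\<close> and \<open>h\<close> split the factor in \<open>eq2\<close> so
    that it reads \<open>n * D\<theta> (D\<theta> \<phi>2) = h * (D\<theta>
    \<psi>1)\<^sup>2\<close>; on \<open>I\<close>, \<open>c\<close> equals
    \<open>h' / (2 * h)\<close>.\<close>
  define n h c where "n t = ((aR t)\<^sup>2 - (bR t)\<^sup>2) / b'R t" and "h t = (qR t)\<^sup>2 * bR t"
    and "c t = bRt t / (2 * bR t) + qRt t / qR t" for t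
  define aR' bR' qR' A' where "aR' t = deriv a (\<phi>R t) * deriv \<phi>R t"
    and "bR' t = deriv b (\<phi>R t) * deriv \<phi>R t" and "qR' t = deriv q (\<phi>R t) * deriv \<phi>R t"
    and "A' t = deriv (deriv b) (\<phi>R t) * deriv \<phi>R t" for t
  note comp = DERIV_smooth_compose[OF I(1) _ \<phi>R] continuous_on_smooth_compose[OF I(1) _ \<phi>R]
    continuous_on_deriv_smooth_compose[OF I(1) _ \<phi>R]
  have deriv_b: "smooth_on (deriv b) UNIV" by (rule smooth_on_deriv[OF open_UNIV b(1)])
  have der: "(aR has_real_derivative aR' t) (at t)" "(bR has_real_derivative bR' t) (at t)"
    "(qR has_real_derivative qR' t) (at t)" "(b'R has_real_derivative A' t) (at t)" if "t \<in> I" for t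
    unfolding aR bR qR b'R aR'_def bR'_def qR'_def A'_def
    by (intro comp(1) a(1) b(1) q deriv_b that)+
  have cont: "continuous_on I aR" "continuous_on I bR" "continuous_on I qR" "continuous_on I b'R"
    "continuous_on I aR'" "continuous_on I bR'" "continuous_on I qR'" "continuous_on I A'"
    unfolding aR bR qR b'R aR'_def bR'_def qR'_def A'_def
    by (intro comp(2,3) a(1) b(1) q deriv_b)+
  have bRt_eq: "bRt t = bR' t" and qRt_eq: "qRt t = qR' t" if "t \<in> I" for t
    unfolding bRt qRt using DERIV_imp_deriv der(2,3)[OF that] by blast+
  have aR_pos: "aR t > 0" and bR_pos: "bR t > 0" for t using a(2) b(2) by (simp_all add: aR bR)
  \<comment> \<open>Positivity excludes \<open>aR t = - bR t\<close>, so distinct values have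
    distinct squares.\<close>
  have ab: "(aR t)\<^sup>2 - (bR t)\<^sup>2 \<noteq> 0" if "t \<in> I" for t
    using nondegenerate(1)[OF that] aR_pos[of t] bR_pos[of t] by (simp add: power2_eq_iff_nonneg)
  define n' where "n' t = ((2 * aR t * aR' t - 2 * bR t * bR' t) * b'R t
    - ((aR t)\<^sup>2 - (bR t)\<^sup>2) * A' t) / (b'R t * b'R t)" for t
  define h' where "h' t = 2 * qR t * qR' t * bR t + (qR t)\<^sup>2 * bR' t" for t
  interpret coupled_system I b'R A' n n' h h' c \<phi>2 \<psi>1
  proof
    fix t assume t: "t \<in> I"
    show "(n has_real_derivative n' t) (at t)" unfolding n_def n'_def
      using der[OF t] nondegenerate(2)[OF t] by (auto intro!: derivative_eq_intros)
    show "(h has_real_derivative h' t) (at t)" unfolding h_def h'_def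
      using der[OF t] by (auto intro!: derivative_eq_intros)
    show "n t \<noteq> 0" using ab[OF t] nondegenerate(2)[OF t] by (simp add: n_def)
    show "h' t = 2 * c t * h t" unfolding h'_def h_def c_def bRt_eq[OF t] qRt_eq[OF t]
      using bR_pos[of t] nondegenerate(3)[OF t] by (simp add: field_simps power2_eq_square)
    show "n t * D\<theta> (D\<theta> \<phi>2) x t = h t * (D\<theta> \<psi>1 x t)\<^sup>2" for x
      unfolding eq2[OF t] n_def h_def using ab[OF t] nondegenerate(2)[OF t] by simp
    show "D\<theta> (\<lambda>x t. Dt \<psi>1 x t + b'R t * \<phi>2 x t * D\<theta> \<psi>1 x t + c t * \<psi>1 x t) x t = 0" for x
      unfolding c_def by (rule eq1[OF t])
  next
    show "continuous_on I n'" unfolding n'_def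
      by (intro continuous_intros cont) (use nondegenerate(2) in auto)
    have "continuous_on I (\<lambda>t. bR' t / (2 * bR t) + qR' t / qR t)"
      by (intro continuous_intros cont) (use bR_pos nondegenerate(3) in \<open>auto simp: less_imp_neq[symmetric]\<close>)
    then show "continuous_on I c"
      by (rule continuous_on_eq) (simp add: c_def bRt_eq qRt_eq)
  qed (fact I(1) der(4) cont(8) nondegenerate(2) \<phi>2 \<psi>1)+
  have bdd: "bounded {x. D\<theta> \<psi>1 x t \<noteq> 0}" if "t \<in> I" for t
    using supp[OF that] compact_imp_bounded bounded_subset closure_subset by metis
  show ?thesis
  proof
    fix t assume t: "t \<in> I"
    \<comment> \<open>Converts the factor \<open>n t * b'R t / 2\<close> of the abstract law into
      the stated one.\<close>
    have "n t * b'R t = (aR t)\<^sup>2 - (bR t)\<^sup>2" using nondegenerate(2)[OF t] by (simp add: n_def)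
    then have D: "((\<lambda>s. (((aR s)\<^sup>2 - (bR s)\<^sup>2) / b'R s) * jump (\<lambda>\<theta>. D\<theta> \<phi>2 \<theta> s)) has_real_derivative
        - (((aR t)\<^sup>2 - (bR t)\<^sup>2) / 2) * jump (\<lambda>\<theta>. (D\<theta> \<phi>2 \<theta> t)\<^sup>2)) (at t)"
      using jump_law(3)[OF bdd t] by (simp add: n_def)
    show "has_jump (\<lambda>\<theta>. D\<theta> \<phi>2 \<theta> t) \<and> has_jump (\<lambda>\<theta>. (D\<theta> \<phi>2 \<theta> t)\<^sup>2) \<and>
      (\<lambda>s. (((aR s)\<^sup>2 - (bR s)\<^sup>2) / b'R s) * jump (\<lambda>\<theta>. D\<theta> \<phi>2 \<theta> s)) differentiable (at t) \<and>
      deriv (\<lambda>s. (((aR s)\<^sup>2 - (bR s)\<^sup>2) / b'R s) * jump (\<lambda>\<theta>. D\<theta> \<phi>2 \<theta> s)) t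
        + (((aR t)\<^sup>2 - (bR t)\<^sup>2) / 2) * jump (\<lambda>\<theta>. (D\<theta> \<phi>2 \<theta> t)\<^sup>2) = 0"
      using jump_law(1,2)[OF bdd t] DERIV_imp_deriv[OF D] D real_differentiable_def by auto
  qed
qed

end
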